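(* Consider the closed-loop system, with state $x=(\eta,p,\lambda)\in\mathbb R^m\times\mathbb R^n\times\mathbb R^n$, $$\dot x=\begin{bmatrix}0&D^T&0\\-D&-A&Q_g^{-1}+Q_d^{-1}\\0&-Q_g^{-1}-Q_d^{-1}&-L_c\end{bmatrix}\nabla H(x)-\begin{bmatrix}0\\Q_g^{-1}c+Q_d^{-1}b\\0\end{bmatrix},\qquad H(x)=\tfrac12p^TM^{-1}p-\mathbf 1^T\Gamma\cos\eta+\tfrac12\lambda^T\lambda,$$ that is, $\dot\eta=D^TM^{-1}p$, $\ \dot p=-D\Gamma\sin\eta-AM^{-1}p+(Q_g^{-1}+Q_d^{-1})\lambda-Q_g^{-1}c-Q_d^{-1}b$, $\ \dot\lambda=-(Q_g^{-1}+Q_d^{-1})M^{-1}p-L_c\lambda$, with all data as in the context. Let $$\lambda^*=\frac{\mathbf 1^T(Q_g^{-1}c+Q_d^{-1}b)}{\mathbf 1^T(Q_g^{-1}+Q_d^{-1})\mathbf 1}$$ and let $\Omega_1$ be the set of all $(\bar\eta,\bar p,\bar\lambda)\in\mathbb R^m\times\mathbb R^n\times\mathbb R^n$ such that $$\bar p=0,\qquad 0=-D\Gamma\sin\bar\eta+(Q_g^{-1}+Q_d^{-1})\bar\lambda-Q_g^{-1}c-Q_d^{-1}b,\qquad \bar\lambda=\mathbf 1\lambda^*.$$ Then for every $\bar x=(\bar\eta,\bar p,\bar\lambda)\in\Omega_1$ with $\bar\eta_k\in(-\pi/2,\pi/2)$ for all edges $k\in\{1,\dots,m\}$, there exists an open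 neighborhood $\mathcal O$ of $\bar x$ such that every trajectory $x(t)$ of the closed-loop system with initial condition in $\mathcal O$ converges to the set $\Omega_1$ as $t\to\infty$. Moreover, along every such trajectory, the power generations $u_g(t)=Q_g^{-1}(\lambda(t)-c)$ and the power demands $u_d(t)=Q_d^{-1}(b-\lambda(t))$ converge, as $t\to\infty$, to the optimal values $$\bar u_g=Q_g^{-1}(\mathbf 1\lambda^*-c),\qquad \bar u_d=Q_d^{-1}(b-\mathbf 1\lambda^* ).$$
   Context: The power network is a connected undirected graph with node set $\mathcal V=\{1,\dots,n\}$ (buses) and edge set $\mathcal E=\{1,\dots,m\}$ (transmission lines). Each edge is given an arbitrary orientation, and $D\in\mathbb R^{n\times m}$ is the incidence matrix: $D_{ik}=+1$ if $i$ is the positive end of edge $k$, $-1$ if $i$ is the negative end of $k$, and $0$ otherwise. $M=\mathrm{diag}(M_1,\dots,M_n)$ (moments of inertia), $A=\mathrm{diag}(A_1,\dots,A_n)$ (damping constants) and $\Gamma=\mathrm{diag}(\gamma_1,\dots,\gamma_m)$, where $\gamma_k=V_iV_jB_{ij}$ for edge $k=(i,j)$ ($V_i$ constant nodal voltages, $B_{ij}$ line susceptances), are constant diagonal matrices with positive diagonal entries. $Q_g,Q_d\in\mathbb R^{n\times n}$ are symmetric positive definite matrices and $b,c\in\mathbb R^n$. The generation cost is $C(u_g)=\frac12u_g^TQ_gu_g+c^Tu_g$ and the consumer utility is $U(u_d)=-\frac12u_d^TQ_du_d+b^Tu_d$. $D_c\in\mathbb R^{n\times m_c}$ is the incidence matrix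 of a connected communication graph on the $n$ nodes with $m_c$ edges (possibly different from the power network graph), and $L_c=D_cD_c^T$ is its Laplacian. $\mathbf 1$ denotes the all-ones vector of suitable dimension; $\sin$ and $\cos$ of vectors are taken componentwise. "Optimal" refers to the social welfare problem: minimize $C(u_g)-U(u_d)$ over $(u_g,u_d,v)\in\mathbb R^n\times\mathbb R^n\times\mathbb R^{m_c}$ subject to $D_cv-u_g+u_d=0$. Convergence of $x(t)$ to a set means that the distance from $x(t)$ to the set tends to $0$. *)

theory Defs
  imports "HOL-Analysis.Analysis"
begin

text \<open>
  A graph on the nodes \<open>'n\<close> with edges \<open>'m\<close> is given, together with an orientation, by the maps
  sending each edge to its positive and to its negative end. Connectivity ignores the orientation.
  Loops are excluded (a loop would have no well-defined column in the incidence matrix);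
  parallel edges are allowed.
\<close>

definition connected_graph :: "('m \<Rightarrow> 'n) \<Rightarrow> ('m \<Rightarrow> 'n) \<Rightarrow> bool" where
  "connected_graph pos neg \<longleftrightarrow>
     (\<forall>k. pos k \<noteq> neg k) \<and>
     (\<forall>i j. (i, j) \<in> (range (\<lambda>k. (pos k, neg k)) \<union> range (\<lambda>k. (neg k, pos k)))\<^sup>*)"

definition incidence_matrix :: "('m::finite \<Rightarrow> 'n::finite) \<Rightarrow> ('m \<Rightarrow> 'n) \<Rightarrow> real ^ 'm ^ 'n" where
  "incidence_matrix pos neg = (\<chi> i k. if i = pos k then 1 else if i = neg k then -1 else 0)"

definition diag_matrix :: "real ^ 'n \<Rightarrow> real ^ 'n ^ 'n" where
  "diag_matrix d = (\<chi> i j. if i = j then d $ i else 0)"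

definition sym_pos_def :: "real ^ 'n ^ 'n \<Rightarrow> bool" where
  "sym_pos_def Q \<longleftrightarrow> transpose Q = Q \<and> (\<forall>x. x \<noteq> 0 \<longrightarrow> 0 < x \<bullet> (Q *v x))"

definition vec_sin :: "real ^ 'm \<Rightarrow> real ^ 'm" where
  "vec_sin \<eta> = (\<chi> k. sin (\<eta> $ k))"

definition vec_cos :: "real ^ 'm \<Rightarrow> real ^ 'm" where
  "vec_cos \<eta> = (\<chi> k. cos (\<eta> $ k))"

definition gradient :: "('a::real_inner \<Rightarrow> real) \<Rightarrow> 'a \<Rightarrow> 'a" where
  "gradient f x = (THE g. GDERIV f x :> g)"

text \<open>On \<open>real ^ 'm\<close> the constant \<open>1\<close> is the all-ones vector.\<close>

definition hamiltonian ::
  "real ^ 'n ^ 'n \<Rightarrow> real ^ 'm ^ 'm \<Rightarrow> (real ^ 'm) \<times> (real ^ 'n) \<times> (real ^ 'n) \<Rightarrow> real" where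
  "hamiltonian M \<Gamma> = (\<lambda>(\<eta>, p, l).
     1/2 * (p \<bullet> (matrix_inv M *v p)) - 1 \<bullet> (\<Gamma> *v vec_cos \<eta>) + 1/2 * (l \<bullet> l))"

definition closed_loop ::
  "real ^ 'm ^ 'n \<Rightarrow> real ^ 'n ^ 'n \<Rightarrow> real ^ 'n ^ 'n \<Rightarrow> real ^ 'm ^ 'm \<Rightarrow>
   real ^ 'n ^ 'n \<Rightarrow> real ^ 'n ^ 'n \<Rightarrow> real ^ 'n \<Rightarrow> real ^ 'n \<Rightarrow> real ^ 'n ^ 'n \<Rightarrow>
   (real ^ 'm) \<times> (real ^ 'n) \<times> (real ^ 'n) \<Rightarrow> (real ^ 'm) \<times> (real ^ 'n) \<times> (real ^ 'n)" where
  "closed_loop D M A \<Gamma> Qg Qd b c Lc x =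
     (let K = matrix_inv Qg + matrix_inv Qd;
          (h\<eta>, hp, hl) = gradient (hamiltonian M \<Gamma>) x
      in (transpose D *v hp,
          - (D *v h\<eta>) - A *v hp + K *v hl,
          - (K *v hp) - Lc *v hl)
         - (0, matrix_inv Qg *v c + matrix_inv Qd *v b, 0))"

definition is_trajectory :: "('a::real_normed_vector \<Rightarrow> 'a) \<Rightarrow> (real \<Rightarrow> 'a) \<Rightarrow> bool" where
  "is_trajectory F x \<longleftrightarrow> (\<forall>t\<ge>0. (x has_vector_derivative F (x t)) (at t within {0..}))"

definition opt_price ::
  "real ^ 'n ^ 'n \<Rightarrow> real ^ 'n ^ 'n \<Rightarrow> real ^ 'n \<Rightarrow> real ^ 'n \<Rightarrow> real" where
  "opt_price Qg Qd b c =
     (1 \<bullet> (matrix_inv Qg *v c + matrix_inv Qd *v b)) /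
     (1 \<bullet> ((matrix_inv Qg + matrix_inv Qd) *v 1))"

definition Omega1 ::
  "real ^ 'm ^ 'n \<Rightarrow> real ^ 'm ^ 'm \<Rightarrow> real ^ 'n ^ 'n \<Rightarrow> real ^ 'n ^ 'n \<Rightarrow> real ^ 'n \<Rightarrow> real ^ 'n \<Rightarrow>
   ((real ^ 'm) \<times> (real ^ 'n) \<times> (real ^ 'n)) set" where
  "Omega1 D \<Gamma> Qg Qd b c = {(\<eta>, p, l).
     p = 0 \<and>
     0 = - (D *v (\<Gamma> *v vec_sin \<eta>)) + (matrix_inv Qg + matrix_inv Qd) *v l
         - matrix_inv Qg *v c - matrix_inv Qd *v b \<and>
     l = opt_price Qg Qd b c *\<^sub>R 1}"

definition gen_cost :: "real ^ 'n ^ 'n \<Rightarrow> real ^ 'n \<Rightarrow> real ^ 'n \<Rightarrow> real" where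
  "gen_cost Qg c ug = 1/2 * (ug \<bullet> (Qg *v ug)) + c \<bullet> ug"

definition utility :: "real ^ 'n ^ 'n \<Rightarrow> real ^ 'n \<Rightarrow> real ^ 'n \<Rightarrow> real" where
  "utility Qd b ud = - 1/2 * (ud \<bullet> (Qd *v ud)) + b \<bullet> ud"

definition welfare_optimal ::
  "real ^ 'n ^ 'n \<Rightarrow> real ^ 'n ^ 'n \<Rightarrow> real ^ 'n \<Rightarrow> real ^ 'n \<Rightarrow> real ^ 'c ^ 'n \<Rightarrow>
   (real ^ 'n) \<times> (real ^ 'n) \<times> (real ^ 'c) \<Rightarrow> bool" where
  "welfare_optimal Qg Qd b c Dc =
     is_arg_min (\<lambda>(ug, ud, v). gen_cost Qg c ug - utility Qd b ud)
                (\<lambda>(ug, ud, v). Dc *v v - ug + ud = 0)"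

text \<open>The gradient of the Hamiltonian exists, and the closed loop has the expected explicit form.\<close>

lemma gradient_eqI:
  assumes "GDERIV f x :> g"
  shows "gradient f x = g"
  unfolding gradient_def
proof (rule the_equality)
  fix g' assume "GDERIV f x :> g'"
  with assms have "(\<lambda>h. h \<bullet> g') = (\<lambda>h. h \<bullet> g)"
    unfolding gderiv_def by (rule has_derivative_unique[rotated])
  then have "\<forall>h. h \<bullet> g' = h \<bullet> g" by meson
  then show "g' = g" by (rule vector_eq_ldot[THEN iffD1])
qed (rule assms)

lemma diag_matrix_mult_vec: "diag_matrix d *v x = d * x"
  by (simp add: diag_matrix_def matrix_vector_mult_def vec_eq_iff if_distrib[where f="\<lambda>a. a * _"]
      cong: if_cong)

lemma matrix_inv_diag_matrix:
  assumes "\<And>i. d $ i \<noteq> 0"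
  shows "matrix_inv (diag_matrix d) = diag_matrix (\<chi> i. 1 / d $ i)"
proof -
  let ?A = "diag_matrix d" and ?B = "diag_matrix (\<chi> i. 1 / d $ i)"
  have "?A *v (?B *v x) = x" "?B *v (?A *v x) = x" for x
    unfolding diag_matrix_mult_vec using assms by (simp_all add: vec_eq_iff)
  then have "?A ** ?B = mat 1" "?B ** ?A = mat 1"
    unfolding matrix_eq matrix_vector_mul_assoc[symmetric] matrix_vector_mul_lid by blast+
  then have "\<exists>A'. ?A ** A' = mat 1 \<and> A' ** ?A = mat 1"
    by blast
  from someI_ex[OF this] have inv: "?A ** matrix_inv ?A = mat 1"
    unfolding matrix_inv_def by (rule conjunct1)
  have "matrix_inv ?A = (?B ** ?A) ** matrix_inv ?A"
    unfolding \<open>?B ** ?A = mat 1\<close> matrix_mul_lid by (rule refl)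
  also have "\<dots> = ?B"
    unfolding matrix_mul_assoc[symmetric] inv by (rule matrix_mul_rid)
  finally show ?thesis .
qed

lemma GDERIV_hamiltonian:
  fixes m :: "real ^ 'n" and \<gamma> :: "real ^ 'm"
  assumes "\<And>i. 0 < m $ i"
  shows "GDERIV (hamiltonian (diag_matrix m) (diag_matrix \<gamma>)) (\<eta>, p, l)
           :> (diag_matrix \<gamma> *v vec_sin \<eta>, matrix_inv (diag_matrix m) *v p, l)"
proof -
  define r where "r = (\<chi> i. 1 / m $ i)"
  have "m $ i \<noteq> 0" for i
    using assms[of i] by simp
  then have inv: "matrix_inv (diag_matrix m) = diag_matrix r"
    unfolding r_def by (rule matrix_inv_diag_matrix)
  have H: "hamiltonian (diag_matrix m) (diag_matrix \<gamma>) =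
    (\<lambda>x. 1/2 * (\<Sum>i\<in>UNIV. (fst (snd x) $ i) * (r $ i * (fst (snd x) $ i)))
        - (\<Sum>k\<in>UNIV. \<gamma> $ k * cos (fst x $ k)) + 1/2 * (snd (snd x) \<bullet> snd (snd x)))"
    by (rule ext) (simp add: hamiltonian_def inv diag_matrix_mult_vec inner_vec_def vec_cos_def
        split: prod.split)
  let ?F = "at (\<eta>, p, l)"
  have p': "((\<lambda>x. fst (snd x) $ i) has_derivative (\<lambda>h. fst (snd h) $ i)) ?F" for i
    by (intro bounded_linear_imp_has_derivative bounded_linear_compose[OF bounded_linear_vec_nth]
        bounded_linear_compose[OF bounded_linear_fst] bounded_linear_snd)
  have \<eta>': "((\<lambda>x. fst x $ k) has_derivative (\<lambda>h. fst h $ k)) ?F" for k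
    by (intro bounded_linear_imp_has_derivative bounded_linear_compose[OF bounded_linear_vec_nth]
        bounded_linear_fst)
  have l': "((\<lambda>x. snd (snd x)) has_derivative (\<lambda>h. snd (snd h))) ?F"
    by (intro bounded_linear_imp_has_derivative bounded_linear_compose[OF bounded_linear_snd]
        bounded_linear_snd)
  have "((\<lambda>x. \<Sum>i\<in>UNIV. fst (snd x) $ i * (r $ i * fst (snd x) $ i)) has_derivative
      (\<lambda>h. \<Sum>i\<in>UNIV. p $ i * (r $ i * fst (snd h) $ i) + fst (snd h) $ i * (r $ i * p $ i))) ?F"
    by (rule has_derivative_sum)
       (use has_derivative_mult[OF p' has_derivative_mult_right[OF p']] in \<open>simp only: fst_conv snd_conv\<close>)
  moreover have "((\<lambda>x. \<Sum>k\<in>UNIV. \<gamma> $ k * cos (fst x $ k)) has_derivative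
      (\<lambda>h. \<Sum>k\<in>UNIV. \<gamma> $ k * (fst h $ k * - sin (\<eta> $ k)))) ?F"
    by (rule has_derivative_sum, rule has_derivative_mult_right)
       (use has_derivative_cos[OF \<eta>'] in \<open>simp only: fst_conv snd_conv\<close>)
  moreover have "((\<lambda>x. snd (snd x) \<bullet> snd (snd x)) has_derivative
      (\<lambda>h. l \<bullet> snd (snd h) + snd (snd h) \<bullet> l)) ?F"
    using has_derivative_inner[OF l' l'] by (simp only: snd_conv)
  ultimately have "(hamiltonian (diag_matrix m) (diag_matrix \<gamma>) has_derivative (\<lambda>h.
      1/2 * (\<Sum>i\<in>UNIV. p $ i * (r $ i * fst (snd h) $ i) + fst (snd h) $ i * (r $ i * p $ i))
      - (\<Sum>k\<in>UNIV. \<gamma> $ k * (fst h $ k * - sin (\<eta> $ k)))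
      + 1/2 * (l \<bullet> snd (snd h) + snd (snd h) \<bullet> l))) ?F"
    unfolding H by (intro has_derivative_add has_derivative_diff has_derivative_mult_right)
  moreover have "1/2 * (\<Sum>i\<in>UNIV. p $ i * (r $ i * fst (snd h) $ i) + fst (snd h) $ i * (r $ i * p $ i))
      = fst (snd h) \<bullet> (diag_matrix r *v p)" for h :: "(real ^ 'm) \<times> (real ^ 'n) \<times> (real ^ 'n)"
    unfolding sum_distrib_left
    by (simp add: inner_vec_def diag_matrix_mult_vec mult_ac)
  moreover have "(\<Sum>k\<in>UNIV. \<gamma> $ k * (fst h $ k * - sin (\<eta> $ k)))
      = - (fst h \<bullet> (diag_matrix \<gamma> *v vec_sin \<eta>))"
    for h :: "(real ^ 'm) \<times> (real ^ 'n) \<times> (real ^ 'n)"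
    by (simp add: inner_vec_def diag_matrix_mult_vec vec_sin_def sum_negf mult_ac)
  ultimately show ?thesis
    unfolding gderiv_def inv by (simp add: inner_prod_def inner_commute add_ac)
qed

lemma closed_loop_explicit:
  assumes "\<And>i. 0 < m $ i"
  shows "closed_loop D (diag_matrix m) A (diag_matrix \<gamma>) Qg Qd b c Lc (\<eta>, p, l) =
     (transpose D *v (matrix_inv (diag_matrix m) *v p),
      - (D *v (diag_matrix \<gamma> *v vec_sin \<eta>)) - A *v (matrix_inv (diag_matrix m) *v p)
        + (matrix_inv Qg + matrix_inv Qd) *v l - matrix_inv Qg *v c - matrix_inv Qd *v b,
      - ((matrix_inv Qg + matrix_inv Qd) *v (matrix_inv (diag_matrix m) *v p)) - Lc *v l)"
  unfolding closed_loop_def gradient_eqI[OF GDERIV_hamiltonian[OF assms]]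
  by (simp add: Let_def)

end

theory Submission
  imports Defs
begin

text \<open>
  The shifted Hamiltonian \<open>H x - H x' - (x - x') \<bullet> \<nabla>H x'\<close> at an equilibrium \<open>x'\<close> has derivative
  \<open>- \<omega> \<bullet> A \<omega> - |Dc\<^sup>T \<lambda>|\<^sup>2\<close> with \<open>\<omega> = inverse M p\<close> along trajectories, and it has a strict local
  minimum at \<open>x'\<close> when all angles lie in \<open>(- \<pi>/2, \<pi>/2)\<close>, so trajectories starting nearby stay in a
  compact ball. Barbalat's lemma, applied to the shifted Hamiltonian and then to \<open>p\<close>, shows that the
  dissipation and \<open>dp/dt\<close> tend to zero; their common zeros lie in \<open>\<Omega>\<^sub>1\<close>, because the kernel of \<open>Dc\<^sup>T\<close>
  consists of the constant vectors. Optimality follows by expanding the quadratic welfare around the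
  candidate.
\<close>

section \<open>Asymptotics of trajectories in compact sets\<close>

text \<open>Uniform continuity keeps \<open>f'\<close> within \<open>e / 2\<close> of
  \<open>f' t\<close> on a window of fixed length \<open>h\<close>, so
  \<open>f (t + h) - f t\<close> differs from \<open>h *\<^sub>R f' t\<close> by at most
  \<open>h * (e / 2)\<close>. The increment itself tends to zero because \<open>f\<close> converges.
  Vector values are allowed so that the lemma also applies to the momenta.\<close>

lemma barbalat:
  fixes f f' :: "real \<Rightarrow> 'a::real_normed_vector"
  assumes deriv: "\<And>t. 0 \<le> t \<Longrightarrow> (f has_vector_derivative f' t) (at t within {0..})"
    and lim: "(f \<longlongrightarrow> L) at_top"
    and uc: "uniformly_continuous_on {0..} f'"
  shows "(f' \<longlongrightarrow> 0) at_top"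
proof (rule tendstoI)
  fix e :: real assume e: "0 < e"
  obtain d where d: "0 < d"
    "\<And>s t. s \<in> {0..} \<Longrightarrow> t \<in> {0..} \<Longrightarrow> dist t s < d \<Longrightarrow> dist (f' t) (f' s) < e / 2"
    using uc[unfolded uniformly_continuous_on_def, rule_format, of "e / 2"] e by auto
  \<comment> \<open>Half of \<open>d\<close> keeps every point of the closed window
    \<open>{t..t + h}\<close> strictly closer than \<open>d\<close> to \<open>t\<close>.\<close>
  define h where "h = d / 2"
  have h: "0 < h" "h < d" using d(1) by (simp_all add: h_def)
  have "filterlim (\<lambda>t. t + h) at_top at_top"
    using filterlim_tendsto_add_at_top[OF tendsto_const filterlim_ident, of h]
    by (simp add: add.commute)
  then have "((\<lambda>t. f (t + h)) \<longlongrightarrow> L) at_top"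
    by (rule filterlim_compose[OF lim])
  then have "((\<lambda>t. f (t + h) - f t) \<longlongrightarrow> L - L) at_top"
    by (intro tendsto_diff lim)
  then have "\<forall>\<^sub>F t in at_top. norm (f (t + h) - f t) < e / 2 * h"
    using tendstoD[of "\<lambda>t. f (t + h) - f t" 0 at_top "e / 2 * h"] e h(1) by simp
  then show "\<forall>\<^sub>F t in at_top. dist (f' t) 0 < e"
    using eventually_ge_at_top[of 0]
  proof eventually_elim
    case (elim t)
    have "norm (f (t + h) - f t - (t + h - t) *\<^sub>R f' t) \<le> norm (t + h - t) * (e / 2)"
    proof (rule vector_differentiable_bound_linearization[where S = "{t..t + h}"])
      fix s assume s: "s \<in> {t..t + h}"
      show "(f has_vector_derivative f' s) (at s within {t..t + h})"
        using s elim(2) by (intro has_vector_derivative_within_subset[OF deriv]) auto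
      show "norm (f' s - f' t) \<le> e / 2"
        using d(2)[of t s] s elim(2) h by (simp add: dist_norm less_imp_le)
    qed (use h in \<open>auto simp: closed_segment_eq_real_ivl\<close>)
    then have "norm (f (t + h) - f t - h *\<^sub>R f' t) \<le> h * (e / 2)"
      using h by simp
    moreover have "norm (h *\<^sub>R f' t) \<le> norm (f (t + h) - f t) + norm (f (t + h) - f t - h *\<^sub>R f' t)"
      using norm_triangle_ineq4[of "f (t + h) - f t" "f (t + h) - f t - h *\<^sub>R f' t"] by simp
    moreover have "norm (h *\<^sub>R f' t) = h * norm (f' t)" "h * (e / 2) = h * e / 2" "e / 2 * h = h * e / 2"
      using h by simp_all
    ultimately have "h * norm (f' t) < h * e"
      using elim(1) by linarith
    then show ?case
      using h by simp
  qed
qed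

text \<open>The vector field is bounded on \<open>C\<close>, so the trajectory is Lipschitz;
  composing with \<open>g\<close>, uniformly continuous on the compact \<open>C\<close>, supplies
  the hypothesis of \<open>barbalat\<close>.\<close>

lemma uniformly_continuous_along_trajectory:
  fixes x :: "real \<Rightarrow> 'a::real_normed_vector" and g :: "'a \<Rightarrow> 'b::metric_space"
  assumes traj: "is_trajectory F x"
    and C: "compact C" "\<And>t. 0 \<le> t \<Longrightarrow> x t \<in> C"
    and cont: "continuous_on C F" "continuous_on C g"
  shows "uniformly_continuous_on {0..} (\<lambda>t. g (x t))"
proof -
  have "bounded (F ` C)"
    by (intro compact_imp_bounded compact_continuous_image cont C)
  then obtain B where B: "\<And>y. y \<in> C \<Longrightarrow> norm (F y) \<le> B"
    unfolding bounded_iff by blast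
  have "norm (x t - x s) \<le> B * norm (t - s)" if "s \<in> {0..}" "t \<in> {0..}" for s t
  proof (rule differentiable_bound[OF _ _ _ that(2,1)])
    fix r :: real assume "r \<in> {0..}"
    then show "(x has_derivative (\<lambda>h. h *\<^sub>R F (x r))) (at r within {0..})"
      using traj by (simp add: is_trajectory_def has_vector_derivative_def)
    show "onorm (\<lambda>h. h *\<^sub>R F (x r)) \<le> B"
      using B[OF C(2)[of r]] \<open>r \<in> {0..}\<close> by (intro onorm_le) (simp add: mult.commute[of B] mult_left_mono)
  qed simp
  then have "B-lipschitz_on {0..} x"
    using B[OF C(2)[of 0]] order_trans[OF norm_ge_zero]
    by (intro lipschitz_onI) (simp_all add: dist_norm)
  then have "uniformly_continuous_on {0..} x"
    by (rule lipschitz_on_uniformly_continuous)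
  moreover have "uniformly_continuous_on (x ` {0..}) g"
    using compact_uniformly_continuous[OF cont(2) C(1)] C(2)
    unfolding uniformly_continuous_on_def by (metis atLeast_iff imageE)
  ultimately show ?thesis
    using uniformly_continuous_on_compose[of "{0..}" x g] by (simp add: o_def)
qed

text \<open>The part of \<open>C\<close> where \<open>k\<close> has norm at least \<open>e\<close>
  is compact and contains no zero of \<open>g\<close>, so \<open>norm (g y)\<close> has a positive
  lower bound there. Once \<open>g (x t)\<close> falls below that bound, \<open>x t\<close> must
  have left this part.\<close>

lemma tendsto_zero_of_zero_set:
  fixes x :: "real \<Rightarrow> 'a::topological_space" and g :: "'a \<Rightarrow> 'b::real_normed_vector"
    and k :: "'a \<Rightarrow> 'c::real_normed_vector"
  assumes C: "compact C" "\<And>t. 0 \<le> t \<Longrightarrow> x t \<in> C"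
    and cont: "continuous_on C g" "continuous_on C k"
    and zero: "\<And>y. y \<in> C \<Longrightarrow> g y = 0 \<Longrightarrow> k y = 0"
    and lim: "((\<lambda>t. g (x t)) \<longlongrightarrow> 0) at_top"
  shows "((\<lambda>t. k (x t)) \<longlongrightarrow> 0) at_top"
proof (rule tendstoI)
  fix e :: real assume e: "0 < e"
  define S where "S = C \<inter> (\<lambda>y. norm (k y)) -` {e..}"
  have "\<exists>d>0. \<forall>y\<in>S. d \<le> norm (g y)"
  proof (cases "S = {}")
    case True
    then show ?thesis by (auto intro: exI[of _ 1])
  next
    case False
    \<comment> \<open>Continuity of \<open>k\<close> is known on \<open>C\<close> only, so the
      preimage is closed relative to \<open>C\<close>, hence the trace on \<open>C\<close> of a
      closed set.\<close>
    obtain U where U: "closed U" "S = U \<inter> C"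
      using continuous_closedin_preimage[OF continuous_on_norm[OF cont(2)], of "{e..}"]
      unfolding closedin_closed S_def by (metis Int_commute closed_atLeast)
    then have "compact S"
      using compact_Int_closed[OF C(1), of U] by (simp add: Int_commute)
    moreover have "continuous_on S (\<lambda>y. norm (g y))"
      by (rule continuous_on_subset[OF continuous_on_norm[OF cont(1)]]) (simp add: S_def)
    ultimately obtain y where y: "y \<in> S" "\<And>z. z \<in> S \<Longrightarrow> norm (g y) \<le> norm (g z)"
      using continuous_attains_inf[of S "\<lambda>y. norm (g y)"] False by blast
    moreover have "g y \<noteq> 0"
      using y(1) zero[of y] e by (auto simp: S_def)
    ultimately show ?thesis
      by (intro exI[of _ "norm (g y)"]) auto
  qed
  then obtain d where d: "0 < d" "\<And>y. y \<in> S \<Longrightarrow> d \<le> norm (g y)" by blast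
  from tendstoD[OF lim d(1)] eventually_ge_at_top[of 0]
  show "\<forall>\<^sub>F t in at_top. dist (k (x t)) 0 < e"
  proof eventually_elim
    case (elim t)
    then have "x t \<notin> S" using d(2)[of "x t"] by auto
    then show ?case using C(2)[of t] elim(2) by (auto simp: S_def)
  qed
qed

text \<open>To leave the ball, the distance to \<open>a\<close> would have to take the value
  \<open>r\<close>. On that sphere \<open>W\<close> is at least \<open>m\<close>, but along
  \<open>x\<close> it never exceeds its initial value, which is below \<open>m\<close>.\<close>

lemma trapped_in_sublevel_ball:
  fixes x :: "real \<Rightarrow> 'a::metric_space"
  assumes cont: "continuous_on {0..} x"
    and decr: "\<And>t. 0 \<le> t \<Longrightarrow> W (x t) \<le> (W (x 0) :: real)"
    and start: "x 0 \<in> ball a r" "W (x 0) < m"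
    and sphere: "\<And>y. y \<in> sphere a r \<Longrightarrow> m \<le> W y"
    and t: "0 \<le> t"
  shows "x t \<in> ball a r"
proof (rule ccontr)
  assume "x t \<notin> ball a r"
  then have "\<exists>s\<ge>0. s \<le> t \<and> dist a (x s) = r"
    using start(1) t
    by (intro IVT') (auto intro!: continuous_intros continuous_on_subset[OF cont])
  then obtain s where "0 \<le> s" "x s \<in> sphere a r" by auto
  with sphere[of "x s"] decr[of s] start(2) show False by simp
qed

lemma nonincreasing_along_trajectory:
  fixes w :: "real \<Rightarrow> real"
  assumes "\<And>t. 0 \<le> t \<Longrightarrow> (w has_vector_derivative w' t) (at t within {0..})"
    and "\<And>t. 0 \<le> t \<Longrightarrow> w' t \<le> 0" and "0 \<le> s" "s \<le> t"
  shows "w t \<le> w s"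
proof -
  have "\<exists>r\<in>{s..t}. w t - w s = (t - s) *\<^sub>R w' r"
    by (intro mvt_very_simple[OF assms(4)]
        has_derivative_subset[OF assms(1)[unfolded has_vector_derivative_def]])
       (use assms(3) in auto)
  then obtain r where "r \<in> {s..t}" "w t - w s = (t - s) * w' r" by auto
  moreover have "(t - s) * w' r \<le> 0"
    using assms(2)[of r] \<open>r \<in> {s..t}\<close> assms(3,4) by (intro mult_nonneg_nonpos) auto
  ultimately show ?thesis by linarith
qed

text \<open>A substitute for LaSalle's principle that needs no flow: a monotone bounded \<open>W\<close> has
  \<open>W' \<rightarrow> 0\<close> by Barbalat's lemma.\<close>

lemma lyapunov_derivative_tendsto_zero:
  fixes x :: "real \<Rightarrow> 'a::real_normed_vector"
  assumes traj: "is_trajectory F x"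
    and C: "compact C" "\<And>t. 0 \<le> t \<Longrightarrow> x t \<in> C"
    and cont: "continuous_on C F" "continuous_on C W" "continuous_on C g"
    and deriv: "\<And>t. 0 \<le> t \<Longrightarrow> ((\<lambda>t. W (x t)) has_vector_derivative - g (x t)) (at t within {0..})"
    and nonneg: "\<And>y. 0 \<le> (g y :: real)"
  shows "((\<lambda>t. g (x t)) \<longlongrightarrow> 0) at_top"
proof -
  \<comment> \<open>Freezing time at 0 for negative arguments makes \<open>w\<close> nonincreasing
    and bounded below on the whole line, so its limit is the infimum of its full range.\<close>
  define w where "w t = W (x (max 0 t))" for t
  have decseq_w: "w t \<le> w s" if "s \<le> t" for s t
    unfolding w_def using that
    by (intro nonincreasing_along_trajectory[OF deriv]) (auto simp: nonneg)
  have "bounded (W ` C)"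
    by (intro compact_imp_bounded compact_continuous_image cont C)
  then obtain B where "\<And>y. y \<in> C \<Longrightarrow> norm (W y) \<le> B"
    unfolding bounded_iff by blast
  then have bound: "- B \<le> w t" for t
    using C(2)[of "max 0 t"] by (force simp: w_def abs_le_iff)
  have "(w \<longlongrightarrow> Inf (range w)) at_top"
  proof (rule order_tendstoI)
    fix a assume "a < Inf (range w)"
    moreover have "Inf (range w) \<le> w t" for t
      using bound by (intro cInf_lower bdd_belowI[of _ "- B"]) auto
    ultimately show "\<forall>\<^sub>F t in at_top. a < w t"
      by (auto intro: always_eventually less_le_trans)
  next
    fix a assume "Inf (range w) < a"
    then obtain s where "w s < a"
      using cInf_lessD[of "range w" a] by auto
    then have "w t < a" if "s \<le> t" for t
      using decseq_w[OF that] by simp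
    then show "\<forall>\<^sub>F t in at_top. w t < a"
      using eventually_ge_at_top[of s] by (rule_tac eventually_mono)
  qed
  moreover have "\<forall>\<^sub>F t in at_top. w t = W (x t)"
    using eventually_ge_at_top[of 0] by eventually_elim (simp add: w_def)
  ultimately have "((\<lambda>t. W (x t)) \<longlongrightarrow> Inf (range w)) at_top"
    by (rule Lim_transform_eventually)
  then have "((\<lambda>t. - g (x t)) \<longlongrightarrow> 0) at_top"
    by (rule barbalat[OF deriv, rotated])
       (intro uniformly_continuous_along_trajectory[OF traj C cont(1)] continuous_intros cont(3))
  then show ?thesis
    using tendsto_minus_cancel_left[of "\<lambda>t. - g (x t)" 0 at_top] by simp
qed

section \<open>The matrices of the network\<close>

lemma inner_transpose_mult_vec:
  fixes A :: "real ^ 'n ^ 'm"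
  shows "x \<bullet> (A *v y) = (transpose A *v x) \<bullet> y"
  by (simp add: dot_lmul_matrix)

text \<open>Positivity excludes a nontrivial kernel, so \<open>Q\<close> is invertible. The
  quadratic form of the inverse at \<open>x\<close> is the form of \<open>Q\<close> at
  \<open>matrix_inv Q *v x\<close>.\<close>

lemma sym_pos_def_inverse:
  fixes Q :: "real ^ 'n ^ 'n"
  assumes "sym_pos_def Q"
  shows "Q *v (matrix_inv Q *v x) = x" "matrix_inv Q *v (Q *v x) = x"
    and "sym_pos_def (matrix_inv Q)"
proof -
  have sym: "transpose Q = Q" and pos: "\<And>x. x \<noteq> 0 \<Longrightarrow> 0 < x \<bullet> (Q *v x)"
    using assms by (auto simp: sym_pos_def_def)
  have "x = 0" if "Q *v x = 0" for x
    using pos[of x] that by (cases "x = 0") auto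
  then have inv: "invertible Q"
    unfolding invertible_left_inverse matrix_left_invertible_ker by blast
  have MI: "Q ** matrix_inv Q = mat 1" "matrix_inv Q ** Q = mat 1"
    using someI_ex[OF inv[unfolded invertible_def]] by (simp_all add: matrix_inv_def)
  show QI: "Q *v (matrix_inv Q *v x) = x" and IQ: "matrix_inv Q *v (Q *v x) = x" for x
    using MI by (simp_all add: matrix_vector_mul_assoc)
  show "sym_pos_def (matrix_inv Q)"
    unfolding sym_pos_def_def
  proof (intro conjI allI impI)
    \<comment> \<open>By symmetry of \<open>Q\<close> the transposed inverse is a left inverse of
      \<open>Q\<close>, and therefore coincides with the inverse.\<close>
    have "transpose (matrix_inv Q) ** Q = mat 1"
      using arg_cong[OF MI(1), of transpose] by (simp add: matrix_transpose_mul sym)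
    then have "transpose (matrix_inv Q) ** (Q ** matrix_inv Q) = matrix_inv Q"
      by (simp add: matrix_mul_assoc)
    then show "transpose (matrix_inv Q) = matrix_inv Q"
      by (simp add: MI)
    fix x :: "real ^ 'n" assume "x \<noteq> 0"
    then have "matrix_inv Q *v x \<noteq> 0"
      using QI[of x] by auto
    from pos[OF this] show "0 < x \<bullet> (matrix_inv Q *v x)"
      by (simp add: QI inner_commute)
  qed
qed

lemma sym_pos_def_add:
  assumes "sym_pos_def Q" "sym_pos_def R"
  shows "sym_pos_def (Q + R)"
  using assms
  by (auto simp: sym_pos_def_def matrix_vector_mult_add_rdistrib inner_add_right transpose_def
      vec_eq_iff intro!: add_pos_pos)

lemma transpose_incidence_matrix_nth:
  assumes "pos k \<noteq> neg k"
  shows "(transpose (incidence_matrix pos neg) *v x) $ k = x $ pos k - x $ neg k"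
proof -
  \<comment> \<open>Distinct ends allow the nested conditional to be split into a difference of two
    indicator sums.\<close>
  have "(transpose (incidence_matrix pos neg) *v x) $ k =
      (\<Sum>i\<in>UNIV. (if i = pos k then x $ i else 0) - (if i = neg k then x $ i else 0))"
    unfolding matrix_vector_mult_def transpose_def incidence_matrix_def
    using assms by (auto intro!: sum.cong)
  then show ?thesis
    by (simp add: sum_subtractf)
qed

text \<open>A kernel vector agrees at the two ends of each edge, and connectivity carries this
  equality along paths. For the communication graph this gives consensus of the prices; for the
  power graph it makes the line flows sum to zero.\<close>

lemma transpose_incidence_matrix_eq_0_iff:
  fixes pos neg :: "'m::finite \<Rightarrow> 'n::finite" and x :: "real ^ 'n"
  assumes "connected_graph pos neg"
  shows "transpose (incidence_matrix pos neg) *v x = 0 \<longleftrightarrow> (\<exists>\<alpha>. x = \<alpha> *\<^sub>R 1)"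
proof
  let ?E = "range (\<lambda>k. (pos k, neg k)) \<union> range (\<lambda>k. (neg k, pos k))"
  have ne: "pos k \<noteq> neg k" and conn: "(i, j) \<in> ?E\<^sup>*" for k i j
    using assms by (auto simp: connected_graph_def)
  have nth: "(transpose (incidence_matrix pos neg) *v y) $ k = y $ pos k - y $ neg k" for y k
    by (rule transpose_incidence_matrix_nth[of pos k neg, OF ne])
  show "\<exists>\<alpha>. x = \<alpha> *\<^sub>R 1" if ker: "transpose (incidence_matrix pos neg) *v x = 0"
  proof -
    have "x $ pos k = x $ neg k" for k
      using nth[of x k] by (simp only: ker zero_index)
    then have step: "x $ i = x $ j" if "(i, j) \<in> ?E" for i j
      using that by auto
    have "x $ i = x $ j" if "(i, j) \<in> ?E\<^sup>*" for i j
      using that by (induction rule: rtrancl_induct) (simp_all only: step)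
    with conn have "x $ i = x $ j" for i j
      by blast
    then have "x = (x $ j) *\<^sub>R 1" for j
      by (simp add: vec_eq_iff)
    then show ?thesis by blast
  qed
  show "transpose (incidence_matrix pos neg) *v x = 0" if "\<exists>\<alpha>. x = \<alpha> *\<^sub>R 1"
    using that nth by (auto simp: vec_eq_iff simp del: transpose_matrix_vector)
qed

text \<open>The Fredholm alternative. The component \<open>z\<close> of \<open>y\<close> orthogonal
  to the range of \<open>A\<close> lies in the kernel of the transpose, so \<open>y\<close> is
  orthogonal to \<open>z\<close> and \<open>z\<close> vanishes. It provides the feasible
  \<open>v\<close> for the optimal generation and demand.\<close>

lemma in_range_if_orthogonal_to_kernel:
  fixes A :: "real ^ 'm ^ 'n"
  assumes "\<And>z. transpose A *v z = 0 \<Longrightarrow> y \<bullet> z = 0"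
  shows "\<exists>v. A *v v = y"
proof -
  have sub: "subspace (range ((*v) A))"
    by (intro linear_subspace_image matrix_vector_mul_linear subspace_UNIV)
  obtain s z where sz: "s \<in> span (range ((*v) A))" "y = s + z"
      "\<And>w. w \<in> span (range ((*v) A)) \<Longrightarrow> orthogonal z w"
    using orthogonal_subspace_decomp_exists[of "range ((*v) A)" y] by metis
  have "(transpose A *v z) \<bullet> w = 0" for w
    using sz(3)[of "A *v w"] unfolding inner_transpose_mult_vec[symmetric]
    by (simp add: orthogonal_def span_base)
  then have "transpose A *v z = 0"
    using inner_eq_zero_iff by blast
  from assms[OF this] have "z \<bullet> z = 0"
    using sz(3)[OF sz(1)] unfolding sz(2)
    by (simp only: orthogonal_def inner_add_left inner_commute[of s z])
  with sz sub show ?thesis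
    by (auto simp: span_eq_iff[THEN iffD2])
qed

section \<open>Optimality\<close>

text \<open>Positive definiteness, applied to the nonzero all-ones vector, makes the denominator of
  the price positive, so the fraction can be cleared.\<close>

lemma opt_price_eq:
  fixes Qg Qd :: "real ^ 'n ^ 'n"
  assumes "sym_pos_def (matrix_inv Qg + matrix_inv Qd)"
  shows "\<alpha> = opt_price Qg Qd b c \<longleftrightarrow>
    \<alpha> * (1 \<bullet> ((matrix_inv Qg + matrix_inv Qd) *v 1)) = 1 \<bullet> (matrix_inv Qg *v c + matrix_inv Qd *v b)"
proof -
  have "(1 :: real ^ 'n) \<noteq> 0" by (simp add: vec_eq_iff)
  then have "0 < (1 :: real ^ 'n) \<bullet> ((matrix_inv Qg + matrix_inv Qd) *v 1)"
    using assms unfolding sym_pos_def_def by blast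
  then show ?thesis
    by (simp add: opt_price_def field_simps)
qed

text \<open>The second-order Taylor expansion, exact for a quadratic form; symmetry of
  \<open>Q\<close> merges the two cross terms.\<close>

lemma quadratic_expansion:
  fixes Q :: "real ^ 'n ^ 'n"
  assumes "sym_pos_def Q"
  shows "1/2 * (u \<bullet> (Q *v u)) =
    1/2 * (u' \<bullet> (Q *v u')) + (u - u') \<bullet> (Q *v u') + 1/2 * ((u - u') \<bullet> (Q *v (u - u')))"
proof -
  have "u' \<bullet> (Q *v u) = u \<bullet> (Q *v u')"
    using assms inner_transpose_mult_vec[of u' Q u]
    by (simp add: sym_pos_def_def inner_commute)
  then show ?thesis
    by (simp add: matrix_vector_mult_diff_distrib inner_diff_left inner_diff_right field_simps)
qed

lemma sym_pos_def_nonneg: "sym_pos_def Q \<Longrightarrow> 0 \<le> x \<bullet> (Q *v x)"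
  by (cases "x = 0") (auto simp: sym_pos_def_def less_imp_le)

lemma sym_pos_def_eq_0_iff: "sym_pos_def Q \<Longrightarrow> x \<bullet> (Q *v x) = 0 \<longleftrightarrow> x = 0"
  by (auto simp: sym_pos_def_def dest: spec[of _ x])

text \<open>The gradients of cost and negative utility at the candidate are \<open>\<mu>1\<close> and \<open>- \<mu>1\<close>, so the linear
  terms cancel as soon as total generation minus total demand agrees.\<close>

lemma welfare_expansion:
  fixes Qg Qd :: "real ^ 'n ^ 'n" and \<mu> :: real
  assumes Q: "sym_pos_def Qg" "sym_pos_def Qd"
    and ug': "ug' = matrix_inv Qg *v (\<mu> *\<^sub>R 1 - c)" and ud': "ud' = matrix_inv Qd *v (b - \<mu> *\<^sub>R 1)"
    and balance: "1 \<bullet> (ug - ud) = 1 \<bullet> (ug' - ud')"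
  shows "gen_cost Qg c ug - utility Qd b ud = gen_cost Qg c ug' - utility Qd b ud'
    + 1/2 * ((ug - ug') \<bullet> (Qg *v (ug - ug'))) + 1/2 * ((ud - ud') \<bullet> (Qd *v (ud - ud')))"
proof -
  have "Qg *v ug' = \<mu> *\<^sub>R 1 - c" "Qd *v ud' = b - \<mu> *\<^sub>R 1"
    by (simp_all add: ug' ud' sym_pos_def_inverse(1)[OF Q(1)] sym_pos_def_inverse(1)[OF Q(2)])
  then have "(ug - ug') \<bullet> (Qg *v ug') = \<mu> * (1 \<bullet> ug) - \<mu> * (1 \<bullet> ug') - c \<bullet> ug + c \<bullet> ug'"
    "(ud - ud') \<bullet> (Qd *v ud') = b \<bullet> ud - b \<bullet> ud' - \<mu> * (1 \<bullet> ud) + \<mu> * (1 \<bullet> ud')"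
    by (simp_all add: inner_diff_left inner_diff_right inner_commute right_diff_distrib)
  moreover have "\<mu> * (1 \<bullet> ug) - \<mu> * (1 \<bullet> ud) = \<mu> * (1 \<bullet> ug') - \<mu> * (1 \<bullet> ud')"
    using balance by (simp add: inner_diff_right right_diff_distrib[symmetric])
  ultimately show ?thesis
    using quadratic_expansion[OF Q(1), of ug ug'] quadratic_expansion[OF Q(2), of ud ud']
    unfolding gen_cost_def utility_def by linarith
qed

text \<open>Since \<open>1\<close> is in the kernel of \<open>transpose Dc\<close>, feasibility
  forces total generation to equal total demand, and \<open>welfare_expansion\<close> applies. Its
  two positive definite remainders give both optimality and uniqueness. The variable
  \<open>v\<close> does not enter the objective, so uniqueness concerns generation and demand
  only.\<close>

lemma welfare_optimal_unique:
  fixes pos neg :: "'c::finite \<Rightarrow> 'n::finite" and Qg Qd :: "real ^ 'n ^ 'n"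
  assumes graph: "connected_graph pos neg" "Dc = incidence_matrix pos neg"
    and Q: "sym_pos_def Qg" "sym_pos_def Qd"
    and ug': "ug' = matrix_inv Qg *v (opt_price Qg Qd b c *\<^sub>R 1 - c)"
    and ud': "ud' = matrix_inv Qd *v (b - opt_price Qg Qd b c *\<^sub>R 1)"
  shows "(\<exists>v. welfare_optimal Qg Qd b c Dc (ug', ud', v)) \<and>
    (\<forall>ug ud v. welfare_optimal Qg Qd b c Dc (ug, ud, v) \<longrightarrow> ug = ug' \<and> ud = ud')"
proof -
  define \<mu> where "\<mu> = opt_price Qg Qd b c"
  note Kpd = sym_pos_def_add[OF sym_pos_def_inverse(3)[OF Q(1)] sym_pos_def_inverse(3)[OF Q(2)]]
  note ug = ug'[folded \<mu>_def] and ud = ud'[folded \<mu>_def]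
  note ker = transpose_incidence_matrix_eq_0_iff[OF graph(1), folded graph(2)]
  have "\<mu> * (1 \<bullet> ((matrix_inv Qg + matrix_inv Qd) *v 1)) = 1 \<bullet> (matrix_inv Qg *v c + matrix_inv Qd *v b)"
    using opt_price_eq[OF Kpd, of \<mu> b c] by (simp add: \<mu>_def)
  \<comment> \<open>With \<open>K\<close> the sum of the two inverses and \<open>q\<close> the
    constant input, \<open>ug' - ud'\<close> equals \<mu> times \<open>K *v 1\<close>, minus
    \<open>q\<close>. The balance is therefore exactly the equation that defines the price.\<close>
  then have bal': "1 \<bullet> (ug' - ud') = 0"
    by (simp add: ug ud matrix_vector_mult_diff_distrib matrix_vector_mult_add_rdistrib
        inner_diff_right inner_add_right matrix_vector_mult_scaleR algebra_simps)
  have "\<exists>v. Dc *v v = ug' - ud'"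
  proof (rule in_range_if_orthogonal_to_kernel)
    fix z assume "transpose Dc *v z = 0"
    then obtain \<alpha> where "z = \<alpha> *\<^sub>R 1" using ker by blast
    then show "(ug' - ud') \<bullet> z = 0" using bal' by (simp add: inner_commute)
  qed
  then obtain v' where v': "Dc *v v' = ug' - ud'" by blast
  have bal: "1 \<bullet> (ug - ud) = 1 \<bullet> (ug' - ud')" if "Dc *v v - ug + ud = 0" for ug ud v
  proof -
    have "transpose Dc *v 1 = 0"
      by (subst ker) (auto intro: exI[of _ 1])
    then have "1 \<bullet> (Dc *v v) = 0"
      by (simp only: inner_transpose_mult_vec inner_zero_left)
    moreover have "ug - ud = Dc *v v" using that by (simp add: algebra_simps)
    ultimately show ?thesis using bal' by simp
  qed
  note expand = welfare_expansion[OF Q ug ud bal]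
  have opt: "welfare_optimal Qg Qd b c Dc (ug', ud', v')"
    unfolding welfare_optimal_def is_arg_min_def
  proof (intro conjI notI)
    show "case (ug', ud', v') of (ug, ud, v) \<Rightarrow> Dc *v v - ug + ud = 0"
      using v' by simp
  next
    assume "\<exists>y. (case y of (ug, ud, v) \<Rightarrow> Dc *v v - ug + ud = 0) \<and>
      (case y of (ug, ud, v) \<Rightarrow> gen_cost Qg c ug - utility Qd b ud)
      < (case (ug', ud', v') of (ug, ud, v) \<Rightarrow> gen_cost Qg c ug - utility Qd b ud)"
    then obtain ug ud v where "Dc *v v - ug + ud = 0"
      "gen_cost Qg c ug - utility Qd b ud < gen_cost Qg c ug' - utility Qd b ud'" by auto
    then show False
      using expand[of v ug ud] sym_pos_def_nonneg[OF Q(1), of "ug - ug'"]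
        sym_pos_def_nonneg[OF Q(2), of "ud - ud'"] by linarith
  qed
  moreover have "ug = ug' \<and> ud = ud'" if "welfare_optimal Qg Qd b c Dc (ug, ud, v)" for ug ud v
  proof -
    have feas: "Dc *v v - ug + ud = 0"
      using that by (simp add: welfare_optimal_def is_arg_min_def)
    have "Dc *v v' - ug' + ud' = 0"
      using v' by simp
    then have "\<not> gen_cost Qg c ug' - utility Qd b ud' < gen_cost Qg c ug - utility Qd b ud"
      using that unfolding welfare_optimal_def is_arg_min_def by fast
    \<comment> \<open>The candidate is feasible, so an optimal point cannot cost more; two
      nonnegative remainders with nonpositive sum both vanish.\<close>
    then have "(ug - ug') \<bullet> (Qg *v (ug - ug')) = 0 \<and> (ud - ud') \<bullet> (Qd *v (ud - ud')) = 0"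
      using expand[OF feas] sym_pos_def_nonneg[OF Q(1), of "ug - ug'"]
        sym_pos_def_nonneg[OF Q(2), of "ud - ud'"] by linarith
    then show ?thesis
      by (simp add: sym_pos_def_eq_0_iff Q)
  qed
  ultimately show ?thesis by blast
qed

section \<open>The closed loop\<close>

text \<open>Strict convexity of \<open>- cos\<close>, as positivity of its Bregman divergence.\<close>

lemma cos_bregman_pos:
  fixes x y :: real
  assumes x: "x \<in> {- pi/2<..<pi/2}" and y: "y \<in> {- pi/2<..<pi/2}" and ne: "x \<noteq> y"
  shows "0 < cos y - cos x - (x - y) * sin y"
proof (cases "y < x")
  case True
  obtain z where z: "y < z" "z < x" "cos x - cos y = (x - y) * - sin z"
    using MVT2[OF True, of cos "\<lambda>z. - sin z"] DERIV_cos by blast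
  \<comment> \<open>By the mean value equation the divergence equals
    \<open>(x - y) * (sin z - sin y)\<close>, and \<open>sin\<close> increases strictly on the
    interval.\<close>
  then have "sin y < sin z"
    using x y by (intro sin_monotone_2pi) auto
  then have "0 < (x - y) * (sin z - sin y)"
    using True by simp
  with z(3) show ?thesis by (simp add: algebra_simps)
next
  case False
  with ne have less: "x < y" by simp
  obtain z where z: "x < z" "z < y" "cos y - cos x = (y - x) * - sin z"
    using MVT2[OF less, of cos "\<lambda>z. - sin z"] DERIV_cos by blast
  then have "sin z < sin y"
    using x y by (intro sin_monotone_2pi) auto
  then have "0 < (y - x) * (sin y - sin z)"
    using less by simp
  with z(3) show ?thesis by (simp add: algebra_simps)
qed

lemma continuous_on_vec_sin [continuous_intros]:
  fixes f :: "'a::t2_space \<Rightarrow> real ^ 'm"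
  shows "continuous_on S f \<Longrightarrow> continuous_on S (\<lambda>x. vec_sin (f x))"
  unfolding vec_sin_def
  by (intro continuous_on_vec_lambda continuous_on_sin
      bounded_linear.continuous_on[OF bounded_linear_vec_nth])

section \<open>The network data, the shifted Hamiltonian and its dissipation\<close>

locale power_network =
  fixes pos neg :: "'m::finite \<Rightarrow> 'n::finite" and pos_c neg_c :: "'c::finite \<Rightarrow> 'n"
    and inertia damping :: "real ^ 'n" and \<gamma> :: "real ^ 'm"
    and Qg Qd :: "real ^ 'n ^ 'n" and b c :: "real ^ 'n"
  assumes power_graph: "connected_graph pos neg" and comm_graph: "connected_graph pos_c neg_c"
    and inertia_pos: "\<And>i. 0 < inertia $ i" and damping_pos: "\<And>i. 0 < damping $ i"
    and weight_pos: "\<And>k. 0 < \<gamma> $ k"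
    and Qg: "sym_pos_def Qg" and Qd: "sym_pos_def Qd"
begin

abbreviation "D \<equiv> incidence_matrix pos neg"
abbreviation "Dc \<equiv> incidence_matrix pos_c neg_c"
abbreviation "M \<equiv> diag_matrix inertia"
abbreviation "A \<equiv> diag_matrix damping"
abbreviation "\<Gamma> \<equiv> diag_matrix \<gamma>"
abbreviation "K \<equiv> matrix_inv Qg + matrix_inv Qd"
abbreviation "q \<equiv> matrix_inv Qg *v c + matrix_inv Qd *v b"
abbreviation "F \<equiv> closed_loop D M A \<Gamma> Qg Qd b c (Dc ** transpose Dc)"
abbreviation "\<Omega> \<equiv> Omega1 D \<Gamma> Qg Qd b c"
abbreviation "H \<equiv> hamiltonian M \<Gamma>"
abbreviation "price \<equiv> opt_price Qg Qd b c"

text \<open>The explicit gradient of \<open>H\<close>, as \<open>GDERIV_H\<close> confirms.\<close>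

definition dH :: "(real ^ 'm) \<times> (real ^ 'n) \<times> (real ^ 'n) \<Rightarrow> (real ^ 'm) \<times> (real ^ 'n) \<times> (real ^ 'n)" where
  "dH x = (\<Gamma> *v vec_sin (fst x), matrix_inv M *v fst (snd x), snd (snd x))"

text \<open>The Bregman divergence of \<open>H\<close> at \<open>x'\<close>: its value and its
  gradient both vanish at \<open>x'\<close>.\<close>

definition shifted_H where
  "shifted_H x' x = H x - H x' - (x - x') \<bullet> dH x'"

text \<open>The last term is the quadratic form of the communication Laplacian, written as a square
  to expose its sign and its zeros.\<close>

definition dissipation :: "(real ^ 'm) \<times> (real ^ 'n) \<times> (real ^ 'n) \<Rightarrow> real" where
  "dissipation x =
    (matrix_inv M *v fst (snd x)) \<bullet> (A *v (matrix_inv M *v fst (snd x)))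
    + (norm (transpose Dc *v snd (snd x)))\<^sup>2"

lemma GDERIV_H: "GDERIV H x :> dH x"
  using GDERIV_hamiltonian[OF inertia_pos, of \<gamma> "fst x" "fst (snd x)" "snd (snd x)"]
  by (simp add: dH_def)

lemma F_eq:
  "F x = (transpose D *v (matrix_inv M *v fst (snd x)),
    - (D *v (\<Gamma> *v vec_sin (fst x))) - A *v (matrix_inv M *v fst (snd x)) + K *v snd (snd x) - q,
    - (K *v (matrix_inv M *v fst (snd x))) - (Dc ** transpose Dc) *v snd (snd x))"
  using closed_loop_explicit[OF inertia_pos, of D A \<gamma> Qg Qd b c "Dc ** transpose Dc"
      "fst x" "fst (snd x)" "snd (snd x)"]
  by (simp add: diff_diff_eq)

lemma K_pos_def: "sym_pos_def K"
  by (intro sym_pos_def_add sym_pos_def_inverse(3) Qg Qd)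

lemma mem_\<Omega>_iff:
  "x \<in> \<Omega> \<longleftrightarrow> fst (snd x) = 0 \<and> D *v (\<Gamma> *v vec_sin (fst x)) = K *v snd (snd x) - q
    \<and> snd (snd x) = price *\<^sub>R 1"
  by (cases x) (auto simp: Omega1_def algebra_simps)

lemma mult_matrix_inv_M: "(matrix_inv M *v p) $ i = p $ i / inertia $ i"
proof -
  have "inertia $ i \<noteq> 0" for i
    using inertia_pos[of i] by simp
  then show ?thesis
    by (simp add: matrix_inv_diag_matrix diag_matrix_mult_vec)
qed

lemma continuous_on_F: "continuous_on S F"
  unfolding F_eq
  by (intro continuous_intros matrix_vector_mult_linear_continuous_on[THEN continuous_on_compose2]) auto

lemma continuous_on_dissipation: "continuous_on S dissipation"
  unfolding dissipation_def
  by (intro continuous_intros matrix_vector_mult_linear_continuous_on[THEN continuous_on_compose2]) auto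

lemma continuous_on_shifted_H: "continuous_on S (shifted_H x')"
proof -
  have "(H has_derivative (\<lambda>h. h \<bullet> dH x)) (at x within S)" for x
    using GDERIV_H[of x] by (simp add: gderiv_def has_derivative_at_withinI)
  then have "continuous_on S H"
    by (rule has_derivative_continuous_on)
  then show ?thesis
    unfolding shifted_H_def by (intro continuous_intros)
qed

lemma damping_term_nonneg: "0 \<le> w \<bullet> (A *v w)"
  and damping_term_eq_0_iff: "w \<bullet> (A *v w) = 0 \<longleftrightarrow> w = 0"
proof -
  have eq: "w \<bullet> (A *v w) = (\<Sum>i\<in>UNIV. damping $ i * (w $ i)\<^sup>2)"
    by (simp add: inner_vec_def diag_matrix_mult_vec power2_eq_square mult_ac)
  have nonneg: "0 \<le> damping $ i * (w $ i)\<^sup>2" for i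
    using damping_pos[of i] by (simp add: mult_nonneg_nonneg)
  show "0 \<le> w \<bullet> (A *v w)"
    unfolding eq by (intro sum_nonneg nonneg)
  have "damping $ i \<noteq> 0" for i
    using damping_pos[of i] by simp
  then show "w \<bullet> (A *v w) = 0 \<longleftrightarrow> w = 0"
    unfolding eq sum_nonneg_eq_0_iff[OF finite nonneg] by (simp add: vec_eq_iff)
qed

lemma dissipation_nonneg: "0 \<le> dissipation x"
  by (simp add: dissipation_def damping_term_nonneg)

lemma dissipation_eq_0D:
  assumes "dissipation x = 0"
  shows "fst (snd x) = 0" "transpose Dc *v snd (snd x) = 0"
proof -
  let ?w = "matrix_inv M *v fst (snd x)"
  have "?w \<bullet> (A *v ?w) = 0 \<and> (norm (transpose Dc *v snd (snd x)))\<^sup>2 = 0"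
    using assms damping_term_nonneg[of ?w] unfolding dissipation_def
    by (subst (asm) add_nonneg_eq_0_iff) auto
  then have w: "?w = 0" and l: "transpose Dc *v snd (snd x) = 0"
    unfolding damping_term_eq_0_iff by simp_all
  show "transpose Dc *v snd (snd x) = 0" by (rule l)
  have "fst (snd x) $ i = 0" for i
    using mult_matrix_inv_M[of "fst (snd x)" i] inertia_pos[of i] by (simp add: w)
  then show "fst (snd x) = 0"
    by (simp add: vec_eq_iff)
qed

text \<open>The couplings through \<open>D\<close> and \<open>K\<close> are skew-symmetric and drop
  out of the power balance, leaving damping and the Laplacian. Subtracting \<open>dH x'\<close>
  cancels the constant input \<open>q\<close> through the force balance at
  \<open>x'\<close>.\<close>

lemma F_inner_shifted_gradient:
  assumes "x' \<in> \<Omega>"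
  shows "F x \<bullet> (dH x - dH x') = - dissipation x"
proof -
  obtain \<eta> p l \<eta>' p' l' where x: "x = (\<eta>, p, l)" and x': "x' = (\<eta>', p', l')"
    by (metis prod.exhaust)
  define w where "w = matrix_inv M *v p"
  define s s' where "s = \<Gamma> *v vec_sin \<eta>" and "s' = \<Gamma> *v vec_sin \<eta>'"
  have eq: "p' = 0" "D *v s' = K *v l' - q" and l': "l' = price *\<^sub>R 1"
    using assms by (auto simp: mem_\<Omega>_iff x' s'_def)
  have "(transpose D *v w) \<bullet> (s - s') = w \<bullet> (D *v s - (K *v l' - q))"
    by (simp add: inner_transpose_mult_vec[symmetric] matrix_vector_mult_diff_distrib eq
        del: transpose_matrix_vector)
  moreover have "(K *v w) \<bullet> (l - l') = w \<bullet> (K *v l) - w \<bullet> (K *v l')"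
  proof -
    have "(transpose K *v w) \<bullet> (l - l') = (K *v w) \<bullet> (l - l')"
      using K_pos_def by (simp only: sym_pos_def_def)
    then show ?thesis
      by (simp only: inner_transpose_mult_vec[symmetric] matrix_vector_mult_diff_distrib inner_diff_right)
  qed
  \<comment> \<open>Equilibrium prices are uniform, so \<open>transpose Dc\<close> annihilates
    \<open>l'\<close> and only the quadratic form of \<open>l\<close> survives.\<close>
  moreover have "((Dc ** transpose Dc) *v l) \<bullet> (l - l') = (norm (transpose Dc *v l))\<^sup>2"
  proof -
    have "transpose Dc *v l' = 0"
      by (subst transpose_incidence_matrix_eq_0_iff[OF comm_graph]) (auto simp: l')
    then have "transpose Dc *v (l - l') = transpose Dc *v l"
      by (simp add: matrix_vector_mult_diff_distrib del: transpose_matrix_vector)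
    then show ?thesis
      unfolding matrix_vector_mul_assoc[symmetric]
      by (simp only: inner_commute[of _ "l - l'"] inner_transpose_mult_vec power2_norm_eq_inner)
  qed
  ultimately show ?thesis
    unfolding F_eq dH_def dissipation_def x x'
    by (simp add: w_def[symmetric] s_def[symmetric] s'_def[symmetric] eq(1) inner_diff_left
        inner_diff_right inner_add_left inner_add_right inner_commute algebra_simps
        del: transpose_matrix_vector)
qed

lemma shifted_H_along_trajectory:
  assumes "is_trajectory F x" "x' \<in> \<Omega>" "0 \<le> t"
  shows "((\<lambda>t. shifted_H x' (x t)) has_vector_derivative - dissipation (x t)) (at t within {0..})"
proof -
  \<comment> \<open>Derivatives within an arbitrary \<open>S\<close> are provided because the chain
    rule asks for one within the image of the half-line under \<open>x\<close>.\<close>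
  have "(shifted_H x' has_derivative (\<lambda>h. h \<bullet> dH y - h \<bullet> dH x')) (at y within S)" for y S
    unfolding shifted_H_def
    by (rule derivative_eq_intros has_derivative_at_withinI[OF GDERIV_H[unfolded gderiv_def]] refl)+ simp
  then have "((shifted_H x' \<circ> x) has_vector_derivative (F (x t) \<bullet> dH (x t) - F (x t) \<bullet> dH x'))
      (at t within {0..})"
    using assms unfolding is_trajectory_def by (intro vector_derivative_diff_chain_within) auto
  then show ?thesis
    using F_inner_shifted_gradient[OF assms(2), of "x t"] by (simp add: o_def inner_diff_right)
qed

text \<open>As \<open>p' = 0\<close>, the shifted Hamiltonian splits into weighted Bregman
  divergences of \<open>- cos\<close> over the edges, the kinetic energy and half the squared price
  deviation. All three are nonnegative, and \<open>x \<noteq> x'\<close> makes one of them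
  positive.\<close>

lemma shifted_H_pos:
  assumes x': "x' \<in> \<Omega>" "\<And>k. fst x' $ k \<in> {- pi/2<..<pi/2}"
    and x: "\<And>k. fst x $ k \<in> {- pi/2<..<pi/2}" "x \<noteq> x'"
  shows "0 < shifted_H x' x"
proof -
  obtain \<eta> p l \<eta>' p' l' where x_eq: "x = (\<eta>, p, l)" and x'_eq: "x' = (\<eta>', p', l')"
    by (metis prod.exhaust)
  have "p' = 0" using x'(1) by (simp add: mem_\<Omega>_iff x'_eq)
  let ?cos = "\<Sum>k\<in>UNIV. \<gamma> $ k * (cos (\<eta>' $ k) - cos (\<eta> $ k) - (\<eta> $ k - \<eta>' $ k) * sin (\<eta>' $ k))"
  let ?kin = "\<Sum>i\<in>UNIV. (p $ i)\<^sup>2 / inertia $ i"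
  have kin: "p \<bullet> (matrix_inv M *v p) = ?kin"
    by (simp add: inner_vec_def mult_matrix_inv_M power2_eq_square)
  have cos: "1 \<bullet> (\<Gamma> *v vec_cos \<eta>') - 1 \<bullet> (\<Gamma> *v vec_cos \<eta>) - (\<eta> - \<eta>') \<bullet> (\<Gamma> *v vec_sin \<eta>') = ?cos"
    by (simp add: inner_vec_def diag_matrix_mult_vec vec_cos_def vec_sin_def
        sum_subtractf[symmetric] algebra_simps)
  have eq: "shifted_H x' x = ?cos + ?kin / 2 + (l - l') \<bullet> (l - l') / 2"
    unfolding cos[symmetric] kin[symmetric]
    by (simp add: shifted_H_def hamiltonian_def dH_def x_eq x'_eq \<open>p' = 0\<close>
        inner_diff_left inner_diff_right inner_commute field_simps)
  have cos_pos: "0 < cos (\<eta>' $ k) - cos (\<eta> $ k) - (\<eta> $ k - \<eta>' $ k) * sin (\<eta>' $ k)"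
    if "\<eta> $ k \<noteq> \<eta>' $ k" for k
    using x'(2)[of k] x(1)[of k] that by (intro cos_bregman_pos) (auto simp: x_eq x'_eq)
  have cos_nonneg: "0 \<le> \<gamma> $ k * (cos (\<eta>' $ k) - cos (\<eta> $ k) - (\<eta> $ k - \<eta>' $ k) * sin (\<eta>' $ k))" for k
    using cos_pos[of k] weight_pos[of k]
    by (cases "\<eta> $ k = \<eta>' $ k") (auto intro!: mult_nonneg_nonneg less_imp_le)
  have kin_nonneg: "0 \<le> (p $ i)\<^sup>2 / inertia $ i" for i
    using inertia_pos[of i] by simp
  have "0 \<le> ?cos" "0 \<le> ?kin"
    by (intro sum_nonneg cos_nonneg kin_nonneg)+
  consider "\<eta> \<noteq> \<eta>'" | "p \<noteq> 0" | "l \<noteq> l'"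
    using x(2) by (auto simp: x_eq x'_eq \<open>p' = 0\<close>)
  then show ?thesis
  proof cases
    case 1
    then obtain k where "\<eta> $ k \<noteq> \<eta>' $ k" by (auto simp: vec_eq_iff)
    with cos_pos[of k] weight_pos[of k] have "0 < ?cos"
      by (intro sum_pos2[of UNIV k] cos_nonneg) auto
    with \<open>0 \<le> ?kin\<close> show ?thesis unfolding eq by (simp add: add_pos_nonneg)
  next
    case 2
    then obtain i where "p $ i \<noteq> 0" by (auto simp: vec_eq_iff)
    with inertia_pos[of i] have "0 < ?kin"
      by (intro sum_pos2[of UNIV i] kin_nonneg) auto
    with \<open>0 \<le> ?cos\<close> show ?thesis unfolding eq by (simp add: add_pos_nonneg add_nonneg_pos)
  next
    case 3
    then have "0 < (l - l') \<bullet> (l - l')" by simp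
    with \<open>0 \<le> ?cos\<close> \<open>0 \<le> ?kin\<close> show ?thesis unfolding eq by (simp add: add_nonneg_pos)
  qed
qed

text \<open>Summing the force balance over all nodes eliminates the line flows and fixes the common price.\<close>

lemma mem_\<Omega>I:
  assumes "dissipation x = 0" "fst (snd (F x)) = 0"
  shows "x \<in> \<Omega>"
proof -
  note p = dissipation_eq_0D(1)[OF assms(1)]
  obtain \<alpha> where \<alpha>: "snd (snd x) = \<alpha> *\<^sub>R 1"
    using dissipation_eq_0D(2)[OF assms(1)] transpose_incidence_matrix_eq_0_iff[OF comm_graph] by blast
  have bal: "D *v (\<Gamma> *v vec_sin (fst x)) = K *v snd (snd x) - q"
    using assms(2) by (simp add: F_eq p algebra_simps)
  have "transpose D *v 1 = 0"
    by (subst transpose_incidence_matrix_eq_0_iff[OF power_graph]) (auto intro: exI[of _ 1])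
  then have "1 \<bullet> (D *v (\<Gamma> *v vec_sin (fst x))) = 0"
    by (subst inner_transpose_mult_vec) (simp only: inner_zero_left)
  then have "\<alpha> * (1 \<bullet> (K *v 1)) = 1 \<bullet> q"
    unfolding bal \<alpha> by (simp add: matrix_vector_mult_scaleR inner_diff_right)
  then have "\<alpha> = price"
    using opt_price_eq[OF K_pos_def] by blast
  with p bal \<alpha> show ?thesis by (simp add: mem_\<Omega>_iff)
qed

text \<open>A closed ball around \<open>x'\<close> fits into the region of admissible angles. On its
  compact sphere the shifted Hamiltonian has a positive lower bound, while it is zero at
  \<open>x'\<close>; trajectories starting in the ball below that bound cannot reach the
  sphere.\<close>

lemma trapping_neighborhood:
  assumes x': "x' \<in> \<Omega>" "\<And>k. fst x' $ k \<in> {- pi/2<..<pi/2}"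
  shows "\<exists>N r. open N \<and> x' \<in> N \<and>
    (\<forall>x t. is_trajectory F x \<longrightarrow> x 0 \<in> N \<longrightarrow> 0 \<le> t \<longrightarrow> x t \<in> cball x' r)"
proof -
  let ?U = "(\<Inter>k. (\<lambda>x. fst x $ k) -` {- pi/2<..<pi/2}) ::
    ((real ^ 'm) \<times> (real ^ 'n) \<times> (real ^ 'n)) set"
  have "open ?U"
    by (intro open_INT ballI open_vimage continuous_intros) auto
  moreover have "x' \<in> ?U" using x'(2) by auto
  ultimately obtain r where r: "0 < r" "cball x' r \<subseteq> ?U"
    by (meson open_contains_cball)
  have pos: "0 < shifted_H x' y" if "y \<in> sphere x' r" for y
  proof (rule shifted_H_pos[OF x'])
    show "fst y $ k \<in> {- pi/2<..<pi/2}" for k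
      using subsetD[OF r(2), of y] that by auto
    show "y \<noteq> x'"
      using r(1) that by auto
  qed
  obtain m where m: "0 < m" "\<And>y. y \<in> sphere x' r \<Longrightarrow> m \<le> shifted_H x' y"
  \<comment> \<open>The minimum is attained on a nonempty sphere; for an empty one any positive
    level serves, here 1.\<close>
  proof (cases "sphere x' r = {}")
    case True
    then show ?thesis using that[of 1] by auto
  next
    case False
    then show ?thesis
      using continuous_attains_inf[OF compact_sphere False continuous_on_shifted_H] pos that by meson
  qed
  define N where "N = ball x' r \<inter> shifted_H x' -` {..<m}"
  have "open N"
    unfolding N_def by (intro open_Int open_ball open_vimage continuous_on_shifted_H) auto
  moreover have "x' \<in> N"
    using r(1) m(1) by (simp add: N_def shifted_H_def)
  moreover have "x t \<in> cball x' r" if traj: "is_trajectory F x" and "x 0 \<in> N" "0 \<le> t" for x t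
  proof -
    have "x t \<in> ball x' r"
    proof (rule trapped_in_sublevel_ball[where W = "shifted_H x'" and m = m])
      show "continuous_on {0..} x"
        using traj unfolding is_trajectory_def
        by (auto simp: continuous_on_eq_continuous_within intro: has_vector_derivative_continuous)
      show "shifted_H x' (x s) \<le> shifted_H x' (x 0)" if "0 \<le> s" for s
        by (rule nonincreasing_along_trajectory[OF shifted_H_along_trajectory[OF traj x'(1)]])
           (use that dissipation_nonneg in auto)
    qed (use \<open>x 0 \<in> N\<close> \<open>0 \<le> t\<close> m in \<open>auto simp: N_def\<close>)
    then show ?thesis by simp
  qed
  ultimately show ?thesis by blast
qed

text \<open>Vanishing dissipation gives \<open>p\<close> tending to 0 and agreement of the prices,
  but not yet the force balance. The second use of \<open>barbalat\<close>, on \<open>p\<close>,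
  supplies the latter in the limit, in place of an invariance argument.\<close>

lemma bounded_trajectory_tendsto_\<Omega>:
  assumes x': "x' \<in> \<Omega>" and traj: "is_trajectory F x"
    and C: "compact C" "\<And>t. 0 \<le> t \<Longrightarrow> x t \<in> C"
  shows "((\<lambda>t. infdist (x t) \<Omega>) \<longlongrightarrow> 0) at_top"
    and "((\<lambda>t. snd (snd (x t))) \<longlongrightarrow> price *\<^sub>R 1) at_top"
proof -
  have deriv: "(x has_vector_derivative F (x t)) (at t within {0..})" if "0 \<le> t" for t
    using traj that by (simp add: is_trajectory_def)
  have diss: "((\<lambda>t. dissipation (x t)) \<longlongrightarrow> 0) at_top"
    by (rule lyapunov_derivative_tendsto_zero[OF traj C, where W = "shifted_H x'"])
       (auto intro: continuous_on_F continuous_on_dissipation continuous_on_shifted_H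
          dissipation_nonneg shifted_H_along_trajectory traj x')
  have p: "((\<lambda>t. fst (snd (x t))) \<longlongrightarrow> 0) at_top"
    by (rule tendsto_zero_of_zero_set[OF C _ _ _ diss])
       (auto intro!: continuous_intros continuous_on_dissipation dissipation_eq_0D)
  have p': "((\<lambda>t. fst (snd (x t))) has_vector_derivative fst (snd (F (x t)))) (at t within {0..})"
    if "0 \<le> t" for t
    using deriv[OF that]
    by (intro bounded_linear.has_vector_derivative[OF bounded_linear_fst]
        bounded_linear.has_vector_derivative[OF bounded_linear_snd])
  have "((\<lambda>t. fst (snd (F (x t)))) \<longlongrightarrow> 0) at_top"
    by (rule barbalat[OF p' p], assumption)
       (intro uniformly_continuous_along_trajectory[OF traj C, of "\<lambda>y. fst (snd (F y))"]
          continuous_intros continuous_on_F)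
  \<comment> \<open>Pairing both quantities yields a single continuous function whose zeros all lie
    in \<Omega>.\<close>
  then have lim: "((\<lambda>t. (dissipation (x t), fst (snd (F (x t))))) \<longlongrightarrow> 0) at_top"
    unfolding zero_prod_def by (intro tendsto_Pair diss)
  have cont: "continuous_on C (\<lambda>y. (dissipation y, fst (snd (F y))))"
    by (intro continuous_intros continuous_on_dissipation continuous_on_F)
  have zero: "y \<in> \<Omega>" if "(dissipation y, fst (snd (F y))) = 0" for y
    using that by (intro mem_\<Omega>I) (auto simp: zero_prod_def)
  \<comment> \<open>Here \<Omega> contains \<open>x'\<close>, so \<open>infdist\<close> is a genuine
    distance and not its default value 0 for the empty set.\<close>
  show "((\<lambda>t. infdist (x t) \<Omega>) \<longlongrightarrow> 0) at_top"
    by (rule tendsto_zero_of_zero_set[OF C cont _ _ lim])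
       (auto intro!: continuous_intros dest: zero)
  have "((\<lambda>t. snd (snd (x t)) - price *\<^sub>R 1) \<longlongrightarrow> 0) at_top"
    by (rule tendsto_zero_of_zero_set[OF C cont _ _ lim])
       (auto intro!: continuous_intros dest!: zero simp: mem_\<Omega>_iff)
  then show "((\<lambda>t. snd (snd (x t))) \<longlongrightarrow> price *\<^sub>R 1) at_top"
    by (simp add: LIM_zero_iff)
qed

text \<open>The radius of the trapping ball is common to all trajectories from \<open>N\<close>, and
  closed balls are compact here.\<close>

lemma local_convergence:
  assumes "x' \<in> \<Omega>" "\<And>k. fst x' $ k \<in> {- pi/2<..<pi/2}"
  shows "\<exists>N. open N \<and> x' \<in> N \<and> (\<forall>x. is_trajectory F x \<longrightarrow> x 0 \<in> N \<longrightarrow>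
    ((\<lambda>t. infdist (x t) \<Omega>) \<longlongrightarrow> 0) at_top \<and>
    ((\<lambda>t. snd (snd (x t))) \<longlongrightarrow> price *\<^sub>R 1) at_top)"
proof -
  obtain N r where N: "open N" "x' \<in> N"
    "\<And>x t. is_trajectory F x \<Longrightarrow> x 0 \<in> N \<Longrightarrow> 0 \<le> t \<Longrightarrow> x t \<in> cball x' r"
    using trapping_neighborhood[OF assms] by blast
  have "((\<lambda>t. infdist (x t) \<Omega>) \<longlongrightarrow> 0) at_top \<and> ((\<lambda>t. snd (snd (x t))) \<longlongrightarrow> price *\<^sub>R 1) at_top"
    if "is_trajectory F x" "x 0 \<in> N" for x
    using bounded_trajectory_tendsto_\<Omega>[OF assms(1) that(1) compact_cball N(3)[OF that]] by blast
  with N(1,2) show ?thesis by blast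
qed

end

theorem theorem1:
  fixes pos neg :: "'m::finite \<Rightarrow> 'n::finite"
    and pos_c neg_c :: "'c::finite \<Rightarrow> 'n"
    and D :: "real ^ 'm ^ 'n" and Dc :: "real ^ 'c ^ 'n" and Lc :: "real ^ 'n ^ 'n"
    and M A :: "real ^ 'n ^ 'n" and \<Gamma> :: "real ^ 'm ^ 'm"
    and inertia damping V :: "real ^ 'n" and B :: "real ^ 'n ^ 'n" and \<gamma> :: "real ^ 'm"
    and Qg Qd :: "real ^ 'n ^ 'n" and b c ug_opt ud_opt :: "real ^ 'n"
  assumes power_graph: "connected_graph pos neg" "D = incidence_matrix pos neg"
    and comm_graph: "connected_graph pos_c neg_c" "Dc = incidence_matrix pos_c neg_c"
      "Lc = Dc ** transpose Dc"
    and M: "M = diag_matrix inertia" "\<forall>i. 0 < inertia $ i"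
    and A: "A = diag_matrix damping" "\<forall>i. 0 < damping $ i"
    and \<Gamma>: "\<Gamma> = diag_matrix \<gamma>" "\<forall>k. 0 < \<gamma> $ k"
      "\<forall>k. \<gamma> $ k = V $ pos k * V $ neg k * B $ pos k $ neg k"
    and Q: "sym_pos_def Qg" "sym_pos_def Qd"
    and ug_opt: "ug_opt = matrix_inv Qg *v (opt_price Qg Qd b c *\<^sub>R 1 - c)"
    and ud_opt: "ud_opt = matrix_inv Qd *v (b - opt_price Qg Qd b c *\<^sub>R 1)"
  shows "(\<forall>\<eta>' p' l'. (\<eta>', p', l') \<in> Omega1 D \<Gamma> Qg Qd b c \<and> (\<forall>k. \<eta>' $ k \<in> {- pi/2 <..< pi/2}) \<longrightarrow>
            (\<exists>N. open N \<and> (\<eta>', p', l') \<in> N \<and>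
              (\<forall>\<eta> p l. is_trajectory (closed_loop D M A \<Gamma> Qg Qd b c Lc) (\<lambda>t. (\<eta> t, p t, l t)) \<and>
                        (\<eta> 0, p 0, l 0) \<in> N \<longrightarrow>
                 ((\<lambda>t. infdist (\<eta> t, p t, l t) (Omega1 D \<Gamma> Qg Qd b c)) \<longlongrightarrow> 0) at_top \<and>
                 ((\<lambda>t. matrix_inv Qg *v (l t - c)) \<longlongrightarrow> ug_opt) at_top \<and>
                 ((\<lambda>t. matrix_inv Qd *v (b - l t)) \<longlongrightarrow> ud_opt) at_top)))
       \<and> (\<exists>v. welfare_optimal Qg Qd b c Dc (ug_opt, ud_opt, v))
       \<and> (\<forall>ug ud v. welfare_optimal Qg Qd b c Dc (ug, ud, v) \<longrightarrow> ug = ug_opt \<and> ud = ud_opt)"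
proof -
  note welfare = welfare_optimal_unique[OF comm_graph(1,2) Q ug_opt ud_opt]
  interpret power_network pos neg pos_c neg_c inertia damping \<gamma> Qg Qd b c
    using assms by unfold_locales auto
  have data: "D = incidence_matrix pos neg"
    "Lc = incidence_matrix pos_c neg_c ** transpose (incidence_matrix pos_c neg_c)"
    "M = diag_matrix inertia" "A = diag_matrix damping" "\<Gamma> = diag_matrix \<gamma>"
    using assms by auto
  have "\<exists>N. open N \<and> (\<eta>', p', l') \<in> N \<and>
      (\<forall>\<eta> p l. is_trajectory (closed_loop D M A \<Gamma> Qg Qd b c Lc) (\<lambda>t. (\<eta> t, p t, l t)) \<and>
         (\<eta> 0, p 0, l 0) \<in> N \<longrightarrow>
         ((\<lambda>t. infdist (\<eta> t, p t, l t) (Omega1 D \<Gamma> Qg Qd b c)) \<longlongrightarrow> 0) at_top \<and>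
         ((\<lambda>t. matrix_inv Qg *v (l t - c)) \<longlongrightarrow> ug_opt) at_top \<and>
         ((\<lambda>t. matrix_inv Qd *v (b - l t)) \<longlongrightarrow> ud_opt) at_top)"
    if equilibrium: "(\<eta>', p', l') \<in> Omega1 D \<Gamma> Qg Qd b c"
      and angles: "\<forall>k. \<eta>' $ k \<in> {- pi/2 <..< pi/2}"
    for \<eta>' p' l'
  proof -
    have "fst (\<eta>', p', l') $ k \<in> {- pi/2 <..< pi/2}" for k
      using angles by simp
    from local_convergence[of "(\<eta>', p', l')", folded data, OF equilibrium this]
    obtain N where N: "open N" "(\<eta>', p', l') \<in> N"
      "\<And>x. is_trajectory (closed_loop D M A \<Gamma> Qg Qd b c Lc) x \<Longrightarrow> x 0 \<in> N \<Longrightarrow>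
        ((\<lambda>t. infdist (x t) (Omega1 D \<Gamma> Qg Qd b c)) \<longlongrightarrow> 0) at_top \<and>
        ((\<lambda>t. snd (snd (x t))) \<longlongrightarrow> opt_price Qg Qd b c *\<^sub>R 1) at_top"
      by blast
    show ?thesis
    proof (intro exI[of _ N] conjI N(1,2) allI impI)
      fix \<eta> p l
      assume "is_trajectory (closed_loop D M A \<Gamma> Qg Qd b c Lc) (\<lambda>t. (\<eta> t, p t, l t)) \<and>
        (\<eta> 0, p 0, l 0) \<in> N"
      then have dist: "((\<lambda>t. infdist (\<eta> t, p t, l t) (Omega1 D \<Gamma> Qg Qd b c)) \<longlongrightarrow> 0) at_top"
        and l: "(l \<longlongrightarrow> opt_price Qg Qd b c *\<^sub>R 1) at_top"
        using N(3)[of "\<lambda>t. (\<eta> t, p t, l t)"] by auto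
      show "((\<lambda>t. infdist (\<eta> t, p t, l t) (Omega1 D \<Gamma> Qg Qd b c)) \<longlongrightarrow> 0) at_top"
        by (rule dist)
      \<comment> \<open>Generation and demand are continuous affine images of the price vector, so
        its limit determines theirs.\<close>
      show "((\<lambda>t. matrix_inv Qg *v (l t - c)) \<longlongrightarrow> ug_opt) at_top"
        "((\<lambda>t. matrix_inv Qd *v (b - l t)) \<longlongrightarrow> ud_opt) at_top"
        unfolding ug_opt ud_opt
        by (intro bounded_linear.tendsto[OF matrix_vector_mul_bounded_linear] tendsto_intros l)+
    qed
  qed
  with welfare show ?thesis by blast
qed

end
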